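(* Let $M>1$ and $\mathcal R=[1/M,M]$. For any $\epsilon\in(0,1]$, given a second-order conic approximation $C_q$ with $q$ variables and second-order conic constraints such that $$K_{\exp}(-\epsilon)\subseteq C_q\subseteq K_{\exp}(\epsilon),$$ we have $q=\Omega\left(1+\dfrac{\log\log(M)}{\log(1/\epsilon)}\right)$.
   Context: For $\alpha\in\mathbb R$, $K_{\exp}(\alpha)=\{\boldsymbol x=(x_1,x_2,x_3)\in\mathcal R^2\times\mathbb R:\ \log(x_1/x_2)\ge x_3/x_2-\alpha\}$. A second-order conic approximation with $q$ variables and second-order conic constraints is a set described, in $(x_1,x_2,x_3)$ and possibly additional real variables, by constraints of the form $(a_1^\top w+b_1,\,a_2^\top w+b_2,\,a_3^\top w+b_3)\in\mathcal L_3$, where $w$ is the vector of all variables and $\mathcal L_3=\{y\in\mathbb R^3:y_3\ge\sqrt{y_1^2+y_2^2}\}$, the number of variables and constraints being $q$; the inclusions are understood for its projection onto $(x_1,x_2,x_3)$. $\Omega(\cdot)$ is the usual order notation, in terms of $M$ and $\epsilon$.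
   Formalization: One Ω-constant for all ε in (0,1) is impossible, since log(1/ε)→0 as ε→1 with M fixed; so the constant is uniform over M>1 and ε≤ε₀, for each ε₀<1, and may depend on ε₀. At ε=1, where the quotient is undefined, only q=Ω(1) is asserted. *)

theory Defs
  imports Complex_Main
begin

definition lorentz3 :: "(real \<times> real \<times> real) set" where
  "lorentz3 = {(y1, y2, y3). y3 \<ge> sqrt (y1\<^sup>2 + y2\<^sup>2)}"

definition Kexp :: "real \<Rightarrow> real \<Rightarrow> (real \<times> real \<times> real) set" where
  "Kexp M \<alpha> = {(x1, x2, x3). x1 \<in> {1 / M..M} \<and> x2 \<in> {1 / M..M} \<and>
                              ln (x1 / x2) \<ge> x3 / x2 - \<alpha>}"

definition affine_form :: "nat \<Rightarrow> (nat \<Rightarrow> real) \<Rightarrow> real \<Rightarrow> (nat \<Rightarrow> real) \<Rightarrow> real" where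
  "affine_form n a b w = (\<Sum>i<n. a i * w i) + b"

(* The j-th of the m constraints has coefficient vectors a j 1, a j 2, a j 3 and constant
   terms b j 1, b j 2, b j 3.  Of the n variables w 0, ..., w (n - 1), the first three are
   the coordinates of the point; the others are additional variables and are projected out. *)
definition conic_projection ::
    "nat \<Rightarrow> nat \<Rightarrow> (nat \<Rightarrow> nat \<Rightarrow> nat \<Rightarrow> real) \<Rightarrow> (nat \<Rightarrow> nat \<Rightarrow> real) \<Rightarrow> (real \<times> real \<times> real) set" where
  "conic_projection n m a b =
     {(x1, x2, x3). \<exists>w. w 0 = x1 \<and> w 1 = x2 \<and> w 2 = x3 \<and>
        (\<forall>j<m. (affine_form n (a j 1) (b j 1) w,
                affine_form n (a j 2) (b j 2) w,
                affine_form n (a j 3) (b j 3) w) \<in> lorentz3)}"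

(* q is the total of the variables (including the three coordinates) and the constraints. *)
definition second_order_conic_approx :: "nat \<Rightarrow> (real \<times> real \<times> real) set \<Rightarrow> bool" where
  "second_order_conic_approx q C \<longleftrightarrow>
     (\<exists>n m a b. 3 \<le> n \<and> n + m = q \<and> C = conic_projection n m a b)"

end

theory Submission
  imports Defs "HOL-Analysis.Analysis" "HOL-Computational_Algebra.Fundamental_Theorem_Algebra"
begin

text \<open>
  Fix \<open>x\<^sub>2 = 1\<close> and \<open>x\<^sub>1 = exp t\<close>: the set \<open>C\<close> then contains a point with third coordinate \<open>t - \<epsilon>\<close> and none
  with third coordinate above \<open>t + \<epsilon>\<close>. With slack variables, membership in \<open>C\<close> becomes the vanishing of
  a nonnegative polynomial \<open>E\<close> of degree 4 in \<open>N \<le> 2 q\<close> variables. For any finite set of parameters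
  \<open>t\<close>, minimising \<open>A E + \<mu> \<Sum> u\<^sub>i\<^sup>6 - x\<^sub>3\<close> with \<open>\<mu>\<close> small and \<open>A\<close> large yields a solution with
  \<open>\<bar>x\<^sub>3 - t\<bar> \<le> 2\<close> of a system \<open>u\<^sub>i\<^sup>5 = g\<^sub>i\<close> that does not depend on \<open>t\<close>, where \<open>g\<^sub>i\<close> has degree at most 4.
  Modulo this system every polynomial reduces to exponents at most 4 in all variables but \<open>x\<^sub>1\<close>, so
  counting dimensions gives a nonzero polynomial \<open>P\<close>, of degree exponential in \<open>q\<close>, such that
  \<open>P(x\<^sub>1, x\<^sub>3) = 0\<close> at all these solutions. Since \<open>exp t\<close> grows faster than powers of \<open>x\<^sub>3 \<approx> t\<close>, such a
  relation cannot hold at too many values of \<open>t\<close>, which bounds \<open>ln M\<close> by a fixed power of \<open>deg P\<close>.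
\<close>

section \<open>Polynomial relations satisfied by approximations of the logarithm\<close>

text \<open>Over the complex numbers \<open>p\<close> splits into linear factors. Moving from
  \<open>x\<close> to \<open>y\<close> multiplies the norm of each by at most
  \<open>1 + norm (y - x) / r\<close>, hence by at most
  \<open>exp (norm (y - x) / r)\<close>.\<close>

lemma poly_norm_le_away_from_roots:
  fixes p :: "complex poly"
  assumes r: "r > 0" and away: "\<And>z. poly p z = 0 \<Longrightarrow> r \<le> norm (x - z)"
  shows "norm (poly p y) \<le> exp (degree p * norm (y - x) / r) * norm (poly p x)"
proof (cases "p = 0")
  case False
  obtain root where root: "smult (lead_coeff p) (\<Prod>i<degree p. [:-root i, 1:]) = p"
    by (rule complex_poly_decompose')
  have eval: "norm (poly p u) = norm (lead_coeff p) * (\<Prod>i<degree p. norm (u - root i))" for u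
    by (subst root [symmetric]) (simp add: poly_prod norm_mult prod_norm)
  have step: "norm (y - root i) \<le> exp (norm (y - x) / r) * norm (x - root i)" if "i < degree p" for i
  proof -
    have "poly p (root i) = 0"
      by (subst root [symmetric]) (use that in \<open>auto simp: poly_prod intro!: bexI [of _ i]\<close>)
    then have far: "r \<le> norm (x - root i)" by (rule away)
    have "norm (y - root i) \<le> norm (y - x) + norm (x - root i)"
      by (metis diff_add_cancel add_diff_eq norm_triangle_ineq)
    also have "norm (y - x) \<le> norm (y - x) / r * norm (x - root i)"
      using mult_left_mono [OF far, of "norm (y - x) / r"] r by simp
    also have "norm (y - x) / r * norm (x - root i) + norm (x - root i)
        = (1 + norm (y - x) / r) * norm (x - root i)"
      by (simp add: algebra_simps)
    also have "\<dots> \<le> exp (norm (y - x) / r) * norm (x - root i)"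
      by (intro mult_right_mono exp_ge_add_one_self) auto
    finally show ?thesis by simp
  qed
  have "norm (poly p y) \<le> norm (lead_coeff p) *
      (\<Prod>i<degree p. exp (norm (y - x) / r) * norm (x - root i))"
    unfolding eval by (intro mult_left_mono prod_mono) (auto simp: step)
  also have "\<dots> = exp (norm (y - x) / r) ^ degree p * norm (poly p x)"
    by (simp add: eval prod.distrib)
  also have "exp (norm (y - x) / r) ^ degree p = exp (degree p * norm (y - x) / r)"
    by (simp add: exp_of_nat_mult [symmetric])
  finally show ?thesis .
qed simp

text \<open>Let \<open>a\<close> be the index of a term of largest norm. If every other term were
  smaller than this norm divided by \<open>card A\<close>, the others together could not cancel
  it.\<close>

lemma sum_zero_two_comparable:
  fixes g :: "'a \<Rightarrow> 'b::real_normed_vector"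
  assumes "finite A" "A \<noteq> {}" "sum g A = 0" and nz: "\<And>a. a \<in> A \<Longrightarrow> g a \<noteq> 0"
  obtains a b where "a \<in> A" "b \<in> A" "a \<noteq> b"
    "norm (g a) \<le> card A * norm (g b)" "norm (g b) \<le> card A * norm (g a)"
proof -
  obtain a where a: "a \<in> A" and a_max: "\<And>b. b \<in> A \<Longrightarrow> norm (g b) \<le> norm (g a)"
    using obtains_MAX [OF assms(1,2), of "\<lambda>a. norm (g a)"] assms(1)
    by (metis Max_ge finite_imageI imageI)
  have c1: "1 \<le> real (card A)"
    using assms by (simp add: Suc_leI card_gt_0_iff)
  have "\<exists>b\<in>A - {a}. norm (g a) \<le> card A * norm (g b)"
  proof (rule ccontr)
    assume none: "\<not> ?thesis"
    have small: "norm (g b) \<le> norm (g a) / card A" if "b \<in> A - {a}" for b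
    proof -
      have "norm (g b) * card A < norm (g a)"
        using none that by (auto simp: not_le mult.commute)
      then show ?thesis using c1 by (simp add: pos_le_divide_eq)
    qed
    have "g a = - sum g (A - {a})"
      using assms a by (simp add: sum.remove [of A a] eq_neg_iff_add_eq_0)
    then have "norm (g a) \<le> (\<Sum>b\<in>A - {a}. norm (g b))"
      by (metis norm_minus_cancel norm_sum)
    also have "\<dots> \<le> (card (A - {a})) * (norm (g a) / card A)"
      using sum_bounded_above [of "A - {a}" "\<lambda>b. norm (g b)", OF small] by simp
    also have "\<dots> = (card A - 1) * norm (g a) / card A"
      using a assms(1) by simp
    also have "\<dots> < norm (g a)"
      using c1 nz [OF a] by (simp add: field_simps of_nat_diff)
    finally show False by simp
  qed
  then obtain b where "b \<in> A" "b \<noteq> a" "norm (g a) \<le> card A * norm (g b)" by auto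
  moreover have "norm (g b) \<le> card A * norm (g a)"
    using a_max [OF \<open>b \<in> A\<close>] mult_right_mono [OF c1, of "norm (g a)"] by simp
  ultimately show ?thesis using that a by blast
qed

text \<open>Group the relation as a sum of \<open>p\<^sub>a(y) exp (a t)\<close>. Where \<open>y\<close> is far from every complex root of
  every \<open>p\<^sub>a\<close>, the logarithm of \<open>\<bar>p\<^sub>a(y)\<bar>\<close> varies by at most a quarter of the variation of \<open>t\<close>, so any two
  of the terms are comparable for at most one sample point; but the sum can vanish only if two
  terms are comparable. The sample points are so sparse that each root spoils at most one of them,
  hence their number is at most the number of roots plus the number of pairs of terms.\<close>

lemma no_bivariate_relation_near_log:
  fixes p :: "nat \<Rightarrow> nat \<Rightarrow> real" and S K :: nat and y :: "nat \<Rightarrow> real" and B :: real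
  defines "B \<equiv> 8 * real S + 20"
  assumes K: "2 * (S + 1)\<^sup>2 \<le> K"
    and near: "\<And>k. k \<le> K \<Longrightarrow> \<bar>y k - B * k\<bar> \<le> 2"
    and rel: "\<And>k. k \<le> K \<Longrightarrow> (\<Sum>a\<le>S. \<Sum>b\<le>S. p a b * exp (B * k) ^ a * y k ^ b) = 0"
    and ab: "a \<le> S" "b \<le> S"
  shows "p a b = 0"
proof (rule ccontr)
  assume pab: "p a b \<noteq> 0"
  define P where "P a = (\<Sum>b\<le>S. monom (complex_of_real (p a b)) b)" for a
  have degP: "degree (P a) \<le> S" for a
    unfolding P_def by (intro degree_sum_le) (auto intro: order_trans [OF degree_monom_le])
  have polyP: "poly (P a) (of_real v) = of_real (\<Sum>b\<le>S. p a b * v ^ b)" for a v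
    by (simp add: P_def poly_sum poly_monom)
  have coeffP: "coeff (P a) b = of_real (p a b)" if "b \<le> S" for a b
    using that by (simp add: P_def coeff_sum)
  define A where "A = {a. a \<le> S \<and> P a \<noteq> 0}"
  have finA: "finite A" and cardA: "card A \<le> S + 1"
    using card_mono [of "{..S}" A] by (auto simp: A_def intro: finite_subset [of _ "{..S}"])
  have "a \<in> A"
    using ab pab coeffP [OF ab(2), of a] by (auto simp: A_def)
  define R where "R = (\<Union>a\<in>A. {z. poly (P a) z = 0})"
  have cardR: "card R \<le> (S + 1) * S"
  proof -
    have "card R \<le> (\<Sum>a\<in>A. card {z. poly (P a) z = 0})"
      unfolding R_def by (rule card_UN_le [OF finA])
    also have "\<dots> \<le> (\<Sum>a\<in>A. S)"
      by (intro sum_mono order_trans [OF card_poly_roots_bound degP]) (auto simp: A_def)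
    also have "\<dots> \<le> (S + 1) * S" using mult_right_mono [OF cardA, of S] by simp
    finally show ?thesis .
  qed
  have finR: "finite R"
    unfolding R_def by (intro finite_UN_I finA poly_roots_finite) (auto simp: A_def)
  \<comment> \<open>Two demands fix \<open>r\<close>: \<open>4 * S \<le> r\<close> makes the growth
    rate at most 1/4, and \<open>2 * r = B - 4\<close> prevents two values of \<open>y\<close>, each
    within 2 of its own multiple of \<open>B\<close>, from lying within \<open>r\<close> of the same
    root.\<close>
  define r where "r = 4 * real S + 8"
  have "r > 0" by (simp add: r_def)
  define Bad where "Bad = {k. k \<le> K \<and> (\<exists>z\<in>R. norm (of_real (y k) - z) < r)}"
  define G where "G = {..K} - Bad"
  have gap: "B \<le> B * real k' - B * real k" if "k < k'" for k k'
  proof -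
    have "B * 1 \<le> B * (real k' - real k)"
      using that by (intro mult_left_mono) (auto simp: B_def)
    then show ?thesis by (simp add: algebra_simps)
  qed
  have "card Bad \<le> card R"
  proof -
    define rt where "rt k = (SOME z. z \<in> R \<and> norm (of_real (y k) - z) < r)" for k
    have rt: "rt k \<in> R \<and> norm (of_real (y k) - rt k) < r" if "k \<in> Bad" for k
      unfolding rt_def by (rule someI_ex) (use that in \<open>auto simp: Bad_def\<close>)
    have sep: "rt k \<noteq> rt k'" if "k < k'" "k \<in> Bad" "k' \<in> Bad" for k k'
    proof
      assume "rt k = rt k'"
      then have "norm (complex_of_real (y k' - y k)) < 2 * r"
        using rt [OF that(2)] rt [OF that(3)]
          norm_triangle_ineq4 [of "of_real (y k') - rt k'" "of_real (y k) - rt k"] by simp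
      then have "y k' - y k < 2 * r" by (simp only: norm_of_real)
      moreover have "\<bar>y k - B * k\<bar> \<le> 2" "\<bar>y k' - B * k'\<bar> \<le> 2"
        using that near by (auto simp: Bad_def)
      ultimately show False using gap [OF that(1)] by (simp add: B_def r_def)
    qed
    have "inj_on rt Bad" by (rule inj_onI) (metis sep linorder_neqE_nat)
    then show ?thesis using rt by (intro card_inj_on_le [OF _ _ finR]) auto
  qed
  define f where "f a k = norm (poly (P a) (of_real (y k))) * exp (a * (B * k))" for a k
  have f_pos: "f a k > 0" if "a \<in> A" "k \<in> G" for a k
  proof -
    have "poly (P a) (of_real (y k)) \<noteq> 0"
    proof
      assume "poly (P a) (of_real (y k)) = 0"
      then have "of_real (y k) \<in> R" using that by (auto simp: R_def)
      then have "k \<in> Bad" using that \<open>r > 0\<close> by (auto simp: Bad_def G_def)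
      with that show False by (simp add: G_def)
    qed
    then show ?thesis by (simp add: f_def)
  qed
  have growth: "norm (poly (P a) (of_real (y k'))) \<le>
      exp (\<bar>y k' - y k\<bar> / 4) * norm (poly (P a) (of_real (y k)))"
    if "a \<in> A" "k \<in> G" for a k k'
  proof -
    have "norm (poly (P a) (of_real (y k'))) \<le>
        exp (degree (P a) * norm (complex_of_real (y k') - of_real (y k)) / r)
          * norm (poly (P a) (of_real (y k)))"
    proof (rule poly_norm_le_away_from_roots [OF \<open>r > 0\<close>])
      fix z assume "poly (P a) z = 0"
      then have "z \<in> R" using that by (auto simp: R_def)
      then show "r \<le> norm (of_real (y k) - z)"
        using that by (force simp: G_def Bad_def)
    qed
    also have "norm (complex_of_real (y k') - of_real (y k)) = \<bar>y k' - y k\<bar>"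
      by (metis norm_of_real of_real_diff)
    also have "degree (P a) * \<bar>y k' - y k\<bar> / r \<le> \<bar>y k' - y k\<bar> / 4"
    proof -
      have "4 * degree (P a) \<le> r" using degP [of a] by (simp add: r_def)
      then have "4 * degree (P a) * \<bar>y k' - y k\<bar> \<le> r * \<bar>y k' - y k\<bar>"
        by (intro mult_right_mono) auto
      then show ?thesis using \<open>r > 0\<close> by (simp add: field_simps)
    qed
    finally show ?thesis by (auto simp: mult_right_mono)
  qed
  \<comment> \<open>Ordering the pair fixes which of the two terms outgrows the other as
    \<open>k\<close> increases.\<close>
  define good where "good k ab \<longleftrightarrow> fst ab \<in> A \<and> snd ab \<in> A \<and> fst ab < snd ab \<and>
      f (fst ab) k \<le> (S + 1) * f (snd ab) k \<and> f (snd ab) k \<le> (S + 1) * f (fst ab) k" for k ab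
  have ex_good: "\<exists>ab. good k ab" if "k \<in> G" for k
  proof -
    define g where "g a = poly (P a) (of_real (y k)) * of_real (exp (B * k) ^ a)" for a
    have norm_g: "norm (g a) = f a k" for a
      by (simp add: g_def f_def norm_mult norm_power exp_of_nat_mult [symmetric])
    have "sum g A = sum g {..S}"
      by (intro sum.mono_neutral_left) (auto simp: A_def g_def)
    also have "\<dots> = of_real (\<Sum>a\<le>S. \<Sum>b\<le>S. p a b * exp (B * k) ^ a * y k ^ b)"
      unfolding g_def polyP of_real_mult [symmetric] of_real_sum [symmetric]
      by (simp only: sum_distrib_right) (simp only: mult_ac)
    also have "\<dots> = 0" using rel [of k] that by (simp add: G_def)
    finally have "sum g A = 0" .
    moreover have "g a \<noteq> 0" if "a \<in> A" for a
      using f_pos [OF that \<open>k \<in> G\<close>] norm_g [of a] by auto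
    ultimately obtain a b where ab: "a \<in> A" "b \<in> A" "a \<noteq> b"
        "f a k \<le> card A * f b k" "f b k \<le> card A * f a k"
      using sum_zero_two_comparable [of A g] finA \<open>a \<in> A\<close> norm_g by (metis empty_iff)
    have "real (card A) * f c k \<le> real (S + 1) * f c k" if "c \<in> A" for c
      using cardA f_pos [OF that \<open>k \<in> G\<close>] by (intro mult_right_mono) auto
    then have "f a k \<le> (S + 1) * f b k" "f b k \<le> (S + 1) * f a k"
      using ab order_trans by blast+
    then have "good k (a, b) \<or> good k (b, a)"
      using ab by (auto simp: good_def)
    then show ?thesis by blast
  qed
  define pr where "pr k = (SOME ab. good k ab)" for k
  have pr: "good k (pr k)" if "k \<in> G" for k
    unfolding pr_def using ex_good [OF that] by (rule someI_ex)
  \<comment> \<open>If both points chose the pair \<open>(c, d)\<close>, then from \<open>k\<close>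
    to \<open>k'\<close> the term of \<open>d\<close> would gain a factor of at least
    \<open>exp ((d - c) * t - D / 2)\<close> on the term of \<open>c\<close>, whereas comparability
    at both points allows at most \<open>(S + 1)\<^sup>2\<close>.\<close>
  have pr_neq: "pr k \<noteq> pr k'" if kk: "k < k'" "k \<in> G" "k' \<in> G" for k k'
  proof
    assume eq: "pr k = pr k'"
    obtain c d where cd: "pr k = (c, d)" by fastforce
    define D where "D = \<bar>y k' - y k\<bar>"
    define t where "t = B * k' - B * k"
    have tB: "B \<le> t" using gap [OF kk(1)] by (simp add: t_def)
    have "\<bar>y k - B * k\<bar> \<le> 2" "\<bar>y k' - B * k'\<bar> \<le> 2"
      using kk near by (auto simp: G_def)
    then have D: "D \<le> t + 4" using tB by (auto simp: D_def t_def B_def)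
    have cdA: "c \<in> A" "d \<in> A" "c < d"
      and 1: "f d k' \<le> (S + 1) * f c k'" and 2: "f c k \<le> (S + 1) * f d k"
      using pr [OF kk(2)] pr [OF kk(3)] unfolding eq [symmetric] cd by (auto simp: good_def)
    have 3: "f c k' \<le> exp (D / 4 + c * t) * f c k"
    proof -
      have "f c k' \<le> (exp (D / 4) * norm (poly (P c) (of_real (y k)))) * exp (c * (B * k'))"
        unfolding f_def D_def using growth [OF cdA(1) kk(2)] by (intro mult_right_mono) auto
      also have "\<dots> = exp (D / 4 + c * t) * f c k"
        by (simp add: f_def t_def exp_add [symmetric] mult_ac) (simp add: exp_add exp_diff algebra_simps)
      finally show ?thesis .
    qed
    have 4: "f d k \<le> exp (D / 4 - d * t) * f d k'"
    proof -
      have "f d k \<le> (exp (D / 4) * norm (poly (P d) (of_real (y k')))) * exp (d * (B * k))"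
        unfolding f_def D_def using growth [OF cdA(2) kk(3), of k]
        by (intro mult_right_mono) (auto simp: abs_minus_commute)
      also have "\<dots> = exp (D / 4 - d * t) * f d k'"
        by (simp add: f_def t_def mult_ac) (simp add: exp_add exp_diff algebra_simps)
      finally show ?thesis .
    qed
    have "f d k' \<le> (S + 1) * (exp (D / 4 + c * t) * ((S + 1) * (exp (D / 4 - d * t) * f d k')))"
      by (rule order_trans [OF 1] order_trans [OF 3] order_trans [OF 2] order_trans [OF 4]
          mult_left_mono order_refl | simp)+
    also have "\<dots> = (S + 1)\<^sup>2 * exp (D / 2 - (real d - c) * t) * f d k'"
      by (simp add: power2_eq_square exp_diff exp_add algebra_simps)
         (simp add: exp_add [symmetric])
    finally have "1 \<le> (S + 1)\<^sup>2 * exp (D / 2 - (real d - c) * t)"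
      using f_pos [OF cdA(2) kk(3)] by (metis mult_le_cancel_right1 mult_1 not_less mult_le_cancel_right)
    \<comment> \<open>The bounds \<open>d - c \<ge> 1\<close> and \<open>D \<le> t + 4\<close>
      reduce the exponent to \<open>2 - t / 2\<close>. Together with \<open>2 * S\<close> from the
      prefactor it is negative, because \<open>t \<ge> B = 8 * S + 20\<close>.\<close>
    also have "\<dots> \<le> exp (real S) ^ 2 * exp (2 - t / 2)"
    proof (intro mult_mono)
      have "real (S + 1) \<le> exp (real S)" using exp_ge_add_one_self [of "real S"] by simp
      then show "real ((S + 1)\<^sup>2) \<le> exp (real S) ^ 2"
        by (metis of_nat_0_le_iff of_nat_power power_mono)
      have "1 * t \<le> (real d - c) * t"
        using cdA tB by (intro mult_right_mono) (auto simp: B_def)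
      then show "exp (D / 2 - (real d - c) * t) \<le> exp (2 - t / 2)" using D by simp
    qed auto
    also have "\<dots> = exp (2 * real S + 2 - t / 2)"
      by (simp add: exp_double [symmetric] exp_add [symmetric] algebra_simps)
    also have "\<dots> < 1" using tB by (simp add: B_def)
    finally show False by simp
  qed
  have "inj_on pr G" by (rule inj_onI) (metis pr_neq linorder_neqE_nat)
  moreover have "pr ` G \<subseteq> {..S} \<times> {..S}"
    using pr by (fastforce simp: good_def A_def mem_Times_iff simp del: split_paired_All dest!: sym [of "(_, _)"])
  ultimately have "card G \<le> card ({..S} \<times> {..S})"
    by (intro card_inj_on_le) auto
  moreover have "card G + card Bad = K + 1"
  proof -
    have "Bad \<subseteq> {..K}" by (auto simp: Bad_def)
    then show ?thesis
      unfolding G_def by (subst card_Diff_subset) (auto intro: finite_subset simp: card_mono le_SucI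
          dest: card_mono [of "{..K}" Bad, OF finite_atMost])
  qed
  \<comment> \<open>The indices 0 to \<open>K\<close> give \<open>K + 1\<close> sample points, but
    the right-hand side is \<open>(S + 1) * (2 * S + 1)\<close>, less than
    \<open>2 * (S + 1)\<^sup>2 \<le> K\<close>.\<close>
  ultimately have "K + 1 \<le> (S + 1) * (S + 1) + (S + 1) * S"
    using \<open>card Bad \<le> card R\<close> cardR by simp
  then show False using K by (simp add: power2_eq_square algebra_simps)
qed

section \<open>Polynomial functions and elimination\<close>

text \<open>Gaussian elimination: a nonzero pivot \<open>A i0 j\<close> clears column
  \<open>j\<close> from the other rows, the induction hypothesis relates these, and the coefficient
  of \<open>i0\<close> is then chosen to cancel column \<open>j\<close>.\<close>

lemma exists_nontrivial_relation:
  fixes A :: "'i \<Rightarrow> 'j \<Rightarrow> 'k::field"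
  assumes "finite J" "finite I" "card J < card I"
  shows "\<exists>c. (\<exists>i\<in>I. c i \<noteq> 0) \<and> (\<forall>j\<in>J. (\<Sum>i\<in>I. c i * A i j) = 0)"
  using assms
proof (induction J arbitrary: I A rule: finite_induct)
  case empty
  then have "I \<noteq> {}" by auto
  then show ?case by (intro exI [of _ "\<lambda>_. 1"]) auto
next
  case (insert j J)
  show ?case
  proof (cases "\<forall>i\<in>I. A i j = 0")
    case True
    with insert.IH [of I A] insert.prems insert.hyps show ?thesis by auto
  next
    case False
    then obtain i0 where i0: "i0 \<in> I" "A i0 j \<noteq> 0" by auto
    define A' where "A' i k = A i k - A i j / A i0 j * A i0 k" for i k
    obtain c where c: "\<exists>i\<in>I - {i0}. c i \<noteq> 0"
      and c0: "\<And>k. k \<in> J \<Longrightarrow> (\<Sum>i\<in>I - {i0}. c i * A' i k) = 0"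
    proof -
      have "card J < card (I - {i0})" using insert.prems insert.hyps i0 by simp
      from insert.IH [OF _ this, of A'] insert.prems that show ?thesis by blast
    qed
    define s where "s = (\<Sum>i\<in>I - {i0}. c i * (A i j / A i0 j))"
    define c' where "c' = c(i0 := - s)"
    have sum_c': "(\<Sum>i\<in>I. c' i * A i k) = (\<Sum>i\<in>I - {i0}. c i * A i k) - s * A i0 k" for k
    proof -
      have "(\<Sum>i\<in>I. c' i * A i k) = - s * A i0 k + (\<Sum>i\<in>I - {i0}. c' i * A i k)"
        using insert.prems i0 by (simp add: sum.remove c'_def)
      also have "(\<Sum>i\<in>I - {i0}. c' i * A i k) = (\<Sum>i\<in>I - {i0}. c i * A i k)"
        by (intro sum.cong) (auto simp: c'_def)
      finally show ?thesis by simp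
    qed
    have "(\<Sum>i\<in>I. c' i * A i j) = 0"
      unfolding sum_c' s_def using i0 by (simp add: sum_distrib_right)
    moreover have "(\<Sum>i\<in>I. c' i * A i k) = 0" if "k \<in> J" for k
    proof -
      have "(\<Sum>i\<in>I - {i0}. c i * A' i k) = (\<Sum>i\<in>I - {i0}. c i * A i k) - s * A i0 k"
        by (simp add: A'_def s_def right_diff_distrib sum_subtractf sum_distrib_right mult.assoc)
      with c0 [OF that] show ?thesis by (simp add: sum_c')
    qed
    moreover have "\<exists>i\<in>I. c' i \<noteq> 0"
      using c by (auto simp: c'_def)
    ultimately show ?thesis by auto
  qed
qed

section \<open>Polynomial functions with a degree bound\<close>

text \<open>Polynomials are taken as functions, and \<open>d\<close> only bounds the total degree.
  As multiplication by a coordinate is the sole rule that raises \<open>d\<close>, rule induction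
  replaces any normal form.\<close>

inductive polyfun :: "nat \<Rightarrow> nat \<Rightarrow> ((nat \<Rightarrow> real) \<Rightarrow> real) \<Rightarrow> bool" for N :: nat where
  const: "polyfun N d (\<lambda>_. c)"
| add: "polyfun N d f \<Longrightarrow> polyfun N d g \<Longrightarrow> polyfun N d (\<lambda>u. f u + g u)"
| coord: "i < N \<Longrightarrow> polyfun N d f \<Longrightarrow> polyfun N (Suc d) (\<lambda>u. u i * f u)"

lemma polyfun_Suc: "polyfun N d f \<Longrightarrow> polyfun N (Suc d) f"
  by (induction rule: polyfun.induct) (auto intro: polyfun.intros)

lemma polyfun_mono:
  assumes "polyfun N d f" "d \<le> e"
  shows "polyfun N e f"
  using assms(2,1) by (induction rule: dec_induct) (auto intro: polyfun_Suc)

lemma polyfun_mult: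
  assumes "polyfun N d f" "polyfun N e g"
  shows "polyfun N (d + e) (\<lambda>u. f u * g u)"
  using assms(1)
proof (induction rule: polyfun.induct)
  case (const d c)
  have "polyfun N e (\<lambda>u. c * g u)"
    using assms(2)
  proof (induction rule: polyfun.induct)
    case (coord i e h)
    from polyfun.coord [OF coord(1,3)] show ?case by (simp add: mult_ac)
  qed (auto intro: polyfun.intros simp: distrib_left)
  then show ?case by (rule polyfun_mono) simp
next
  case (add d f h)
  from polyfun.add [OF add.IH] show ?case by (simp add: distrib_right)
next
  case (coord i d f)
  from polyfun.coord [OF coord(1,3)] show ?case by (simp add: mult_ac)
qed

lemma polyfun_cmult: "polyfun N d f \<Longrightarrow> polyfun N d (\<lambda>u. c * f u)"
  using polyfun_mult [OF polyfun.const [of N 0 c]] by simp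

lemma polyfun_diff: "polyfun N d f \<Longrightarrow> polyfun N d g \<Longrightarrow> polyfun N d (\<lambda>u. f u - g u)"
  using polyfun.add [of N d f, OF _ polyfun_cmult [of N d g "-1"]] by simp

lemma polyfun_proj: "i < N \<Longrightarrow> polyfun N 1 (\<lambda>u. u i)"
  using polyfun.coord [OF _ polyfun.const [of N 0 1], of i] by simp

lemma polyfun_power: "polyfun N d f \<Longrightarrow> polyfun N (k * d) (\<lambda>u. f u ^ k)"
  by (induction k) (auto intro: polyfun.const dest: polyfun_mult)

lemma polyfun_sum:
  "(\<And>i. i \<in> I \<Longrightarrow> polyfun N d (f i)) \<Longrightarrow> polyfun N d (\<lambda>u. \<Sum>i\<in>I. f i u)"
  by (induction I rule: infinite_finite_induct) (auto intro: polyfun.const polyfun.add)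

lemma polyfun_continuous_on: "polyfun N d f \<Longrightarrow> continuous_on S f"
proof (induction rule: polyfun.induct)
  case (coord i d f)
  then show ?case
    by (intro continuous_on_mult continuous_on_subset [OF continuous_on_product_coordinates]) auto
qed (auto intro: continuous_on_const continuous_on_add)

text \<open>Truncated subtraction gives \<open>d - 1 = 0\<close> at \<open>d = 0\<close>, so the
  clause that the derivative then vanishes strengthens the induction: in the product rule for
  \<open>u j * f u\<close> with \<open>d = 0\<close>, the summand \<open>u j * f' u\<close> must
  still have degree 0.\<close>

lemma polyfun_has_partial_derivative:
  assumes "polyfun N d f"
  shows "\<exists>g. polyfun N (d - 1) g \<and> (d = 0 \<longrightarrow> g = (\<lambda>_. 0)) \<and>
    (\<forall>u. ((\<lambda>s. f (u(i := s))) has_real_derivative g u) (at (u i)))"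
  using assms
proof (induction rule: polyfun.induct)
  case (const d c)
  show ?case by (rule exI [of _ "\<lambda>_. 0"]) (auto intro: polyfun.const)
next
  case (add d f h)
  then obtain f' h' where "polyfun N (d - 1) f'" "polyfun N (d - 1) h'"
    "d = 0 \<longrightarrow> f' = (\<lambda>_. 0)" "d = 0 \<longrightarrow> h' = (\<lambda>_. 0)"
    and der: "\<And>u. ((\<lambda>s. f (u(i := s))) has_real_derivative f' u) (at (u i))"
    "\<And>u. ((\<lambda>s. h (u(i := s))) has_real_derivative h' u) (at (u i))"
    by blast
  then show ?case
    by (intro exI [of _ "\<lambda>u. f' u + h' u"] conjI allI DERIV_add polyfun.add der) auto
next
  case (coord j d f)
  then obtain f' where f': "polyfun N (d - 1) f'" "d = 0 \<longrightarrow> f' = (\<lambda>_. 0)"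
    and der: "\<And>u. ((\<lambda>s. f (u(i := s))) has_real_derivative f' u) (at (u i))"
    by blast
  define c :: real where "c = (if j = i then 1 else 0)"
  have deg: "polyfun N d (\<lambda>u. u j * f' u)"
    using f' polyfun.coord [OF coord(1) f'(1)] by (cases d) (auto intro: polyfun.const)
  have proj: "((\<lambda>s. (u(i := s)) j) has_real_derivative c) (at (u i))" for u :: "nat \<Rightarrow> real"
    by (cases "j = i") (auto simp: c_def)
  have "((\<lambda>s. (u(i := s)) j * f (u(i := s))) has_real_derivative (c * f u + u j * f' u)) (at (u i))" for u
    using DERIV_mult [OF proj [of u] der [of u]] by (simp add: mult.commute)
  moreover have "polyfun N d (\<lambda>u. c * f u + u j * f' u)"
    by (intro polyfun.add polyfun_cmult coord deg)
  ultimately show ?case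
    by (intro exI [of _ "\<lambda>u. c * f u + u j * f' u"]) (simp del: fun_upd_apply)
qed

section \<open>Monomials with bounded exponents\<close>

definition monomial :: "nat \<Rightarrow> (nat \<Rightarrow> nat) \<Rightarrow> (nat \<Rightarrow> real) \<Rightarrow> real" where
  "monomial N \<beta> u = (\<Prod>i<N. u i ^ \<beta> i)"

text \<open>Coordinate \<open>0\<close> is the parameter of the system \<open>u i ^ 5 = g i u\<close>; the other exponents can be
  brought below \<open>5\<close>, and each substitution lowers the total degree.\<close>

definition reduced_exponents :: "nat \<Rightarrow> nat \<Rightarrow> (nat \<Rightarrow> nat) set" where
  "reduced_exponents N d =
     {\<beta> \<in> extensional {..<N}. (\<forall>i\<in>{1..<N}. \<beta> i \<le> 4) \<and> (\<Sum>i<N. \<beta> i) \<le> d}"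

lemma reduced_exponents_subset:
  "reduced_exponents N d \<subseteq> PiE {..<N} (\<lambda>i. if i = 0 then {..d} else {..4})"
proof
  fix \<beta> assume \<beta>: "\<beta> \<in> reduced_exponents N d"
  then have "\<beta> i \<le> d" if "i < N" for i
    using member_le_sum [of i "{..<N}" \<beta>] that by (simp add: reduced_exponents_def)
  with \<beta> show "\<beta> \<in> PiE {..<N} (\<lambda>i. if i = 0 then {..d} else {..4})"
    by (auto simp: reduced_exponents_def PiE_iff)
qed

lemma finite_reduced_exponents: "finite (reduced_exponents N d)"
  by (rule finite_subset [OF reduced_exponents_subset finite_PiE]) auto

lemma card_reduced_exponents:
  assumes "N > 0"
  shows "card (reduced_exponents N d) \<le> (d + 1) * 5 ^ (N - 1)"
proof -
  have "card (reduced_exponents N d) \<le> card (PiE {..<N} (\<lambda>i. if i = 0 then {..d} else {..4::nat}))"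
    by (intro card_mono finite_PiE reduced_exponents_subset) auto
  also have "\<dots> = (\<Prod>i<N. if i = 0 then d + 1 else 5)"
    by (subst card_PiE) (auto intro!: prod.cong)
  also have "\<dots> = (d + 1) * 5 ^ (N - 1)"
    using assms by (cases N) (simp_all add: lessThan_Suc_eq_insert_0 prod.reindex)
  finally show ?thesis .
qed

lemma polyfun_monomial: "polyfun N (\<Sum>i<N. \<beta> i) (monomial N \<beta>)"
proof -
  have "polyfun N (\<Sum>i<n. \<beta> i) (\<lambda>u. \<Prod>i<n. u i ^ \<beta> i)" if "n \<le> N" for n
    using that
  proof (induction n)
    case (Suc n)
    then show ?case
      using polyfun_mult [OF _ polyfun_power [OF polyfun_proj [of n N], of "\<beta> n"]] by simp
  qed (simp add: polyfun.const)
  then show ?thesis by (simp add: monomial_def [abs_def])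
qed

lemma monomial_update:
  assumes "i < N"
  shows "monomial N (\<beta>(i := k)) u = u i ^ k * (\<Prod>j\<in>{..<N} - {i}. u j ^ \<beta> j)"
proof -
  have "monomial N (\<beta>(i := k)) u = u i ^ k * (\<Prod>j\<in>{..<N} - {i}. u j ^ (\<beta>(i := k)) j)"
    unfolding monomial_def using assms by (subst prod.remove [of _ i]) auto
  then show ?thesis by (auto intro!: prod.cong)
qed

lemma monomial_split:
  assumes "i < N"
  shows "monomial N \<beta> u = u i ^ \<beta> i * (\<Prod>j\<in>{..<N} - {i}. u j ^ \<beta> j)"
  using monomial_update [OF assms, of \<beta> "\<beta> i"] by simp

lemma sum_update:
  assumes "i < (N::nat)"
  shows "(\<Sum>j<N. (\<beta>(i := k)) j) = k + (\<Sum>j\<in>{..<N} - {i}. \<beta> j :: nat)"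
proof -
  have "(\<Sum>j<N. (\<beta>(i := k)) j) = k + (\<Sum>j\<in>{..<N} - {i}. (\<beta>(i := k)) j)"
    using assms by (subst sum.remove [of _ i]) auto
  then show ?thesis by (auto intro!: sum.cong)
qed

section \<open>Reduction modulo the polynomial system\<close>

text \<open>Asking for equality on \<open>Z\<close> only amounts to working in a quotient ring:
  functions that agree on the solution set are identified.\<close>

definition lin_comb_on :: "'u set \<Rightarrow> 'i set \<Rightarrow> ('i \<Rightarrow> 'u \<Rightarrow> real) \<Rightarrow> ('u \<Rightarrow> real) \<Rightarrow> bool" where
  "lin_comb_on Z G h f \<longleftrightarrow> (\<exists>c. \<forall>u\<in>Z. f u = (\<Sum>b\<in>G. c b * h b u))"

lemma lin_comb_on_cong: "lin_comb_on Z G h f \<Longrightarrow> (\<And>u. u \<in> Z \<Longrightarrow> f u = g u) \<Longrightarrow> lin_comb_on Z G h g"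
  by (auto simp: lin_comb_on_def)

lemma lin_comb_on_zero: "lin_comb_on Z G h (\<lambda>_. 0)"
  unfolding lin_comb_on_def by (rule exI [of _ "\<lambda>_. 0"]) simp

lemma lin_comb_on_add:
  assumes "lin_comb_on Z G h f" "lin_comb_on Z G h g"
  shows "lin_comb_on Z G h (\<lambda>u. f u + g u)"
proof -
  obtain c d where "\<forall>u\<in>Z. f u = (\<Sum>b\<in>G. c b * h b u)" "\<forall>u\<in>Z. g u = (\<Sum>b\<in>G. d b * h b u)"
    using assms by (auto simp: lin_comb_on_def)
  then show ?thesis
    unfolding lin_comb_on_def
    by (intro exI [of _ "\<lambda>b. c b + d b"]) (simp add: distrib_right sum.distrib)
qed

lemma lin_comb_on_cmult:
  assumes "lin_comb_on Z G h f"
  shows "lin_comb_on Z G h (\<lambda>u. a * f u)"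
proof -
  obtain c where "\<forall>u\<in>Z. f u = (\<Sum>b\<in>G. c b * h b u)"
    using assms by (auto simp: lin_comb_on_def)
  then show ?thesis
    unfolding lin_comb_on_def
    by (intro exI [of _ "\<lambda>b. a * c b"]) (simp add: sum_distrib_left mult.assoc)
qed

lemma lin_comb_on_sum:
  "(\<And>i. i \<in> I \<Longrightarrow> lin_comb_on Z G h (f i)) \<Longrightarrow> lin_comb_on Z G h (\<lambda>u. \<Sum>i\<in>I. f i u)"
  by (induction I rule: infinite_finite_induct) (auto intro: lin_comb_on_zero lin_comb_on_add)

lemma lin_comb_on_generator:
  assumes "finite G" "b \<in> G"
  shows "lin_comb_on Z G h (h b)"
  unfolding lin_comb_on_def
  by (rule exI [of _ "\<lambda>i. if i = b then 1 else 0"]) (use assms in \<open>simp add: if_distrib [of "\<lambda>x. x * _"] cong: if_cong\<close>)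

lemma lin_comb_on_mono:
  assumes "lin_comb_on Z G h f" "finite G'" "G \<subseteq> G'"
  shows "lin_comb_on Z G' h f"
proof -
  obtain c where c: "\<forall>u\<in>Z. f u = (\<Sum>b\<in>G. c b * h b u)"
    using assms by (auto simp: lin_comb_on_def)
  have "lin_comb_on Z G' h (\<lambda>u. \<Sum>b\<in>G. c b * h b u)"
    using assms by (intro lin_comb_on_sum lin_comb_on_cmult lin_comb_on_generator) auto
  then show ?thesis by (rule lin_comb_on_cong) (use c in auto)
qed

lemma reduced_exponents_mono: "d \<le> e \<Longrightarrow> reduced_exponents N d \<subseteq> reduced_exponents N e"
  by (auto simp: reduced_exponents_def)

text \<open>A coordinate times a reduced monomial is either reduced again or contains a fifth power,
  and replacing that by \<open>g i\<close> gives a polynomial of smaller degree, to which induction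
  on the degree applies.\<close>

lemma polyfun_reduce:
  assumes g: "\<And>i. i \<in> {1..<N} \<Longrightarrow> polyfun N 4 (g i)"
    and Z: "\<And>u i. u \<in> Z \<Longrightarrow> i \<in> {1..<N} \<Longrightarrow> u i ^ 5 = g i u"
    and f: "polyfun N d f"
  shows "lin_comb_on Z (reduced_exponents N d) (monomial N) f"
  using f
proof (induction d arbitrary: f rule: less_induct)
  case (less d)
  \<comment> \<open>The hypothesis for smaller degrees is chained in as a premise, so that the rule
    induction adapts it to the degree of each rule.\<close>
  from less.prems less.IH show ?case
  proof (induction rule: polyfun.induct)
    case (const d c)
    define \<beta> :: "nat \<Rightarrow> nat" where "\<beta> = restrict (\<lambda>_. 0) {..<N}"
    have "\<beta> \<in> reduced_exponents N d"
      by (auto simp: \<beta>_def reduced_exponents_def)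
    then have "lin_comb_on Z (reduced_exponents N d) (monomial N) (\<lambda>u. c * monomial N \<beta> u)"
      by (intro lin_comb_on_cmult lin_comb_on_generator finite_reduced_exponents)
    then show ?case by (rule lin_comb_on_cong) (simp add: monomial_def \<beta>_def)
  next
    case (add d f h)
    then show ?case by (intro lin_comb_on_add) auto
  next
    case (coord i d f)
    obtain c where c: "\<forall>u\<in>Z. f u = (\<Sum>\<beta>\<in>reduced_exponents N d. c \<beta> * monomial N \<beta> u)"
      using coord.prems [of d f] coord.hyps by (auto simp: lin_comb_on_def)
    have step: "lin_comb_on Z (reduced_exponents N (Suc d)) (monomial N) (\<lambda>u. u i * monomial N \<beta> u)"
      if \<beta>: "\<beta> \<in> reduced_exponents N d" for \<beta>
    proof -
      have deg: "\<beta> i + (\<Sum>j\<in>{..<N} - {i}. \<beta> j) \<le> d"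
        using \<beta> sum_update [OF coord(1), of \<beta> "\<beta> i"] by (simp add: reduced_exponents_def)
      show ?thesis
      proof (cases "i = 0 \<or> \<beta> i < 4")
        case True
        have "\<beta>(i := Suc (\<beta> i)) \<in> reduced_exponents N (Suc d)"
          using \<beta> True coord(1) deg
          unfolding reduced_exponents_def mem_Collect_eq sum_update [OF coord(1)]
          by (auto simp: extensional_def)
        then have "lin_comb_on Z (reduced_exponents N (Suc d)) (monomial N)
            (monomial N (\<beta>(i := Suc (\<beta> i))))"
          by (intro lin_comb_on_generator finite_reduced_exponents)
        then show ?thesis
          by (rule lin_comb_on_cong)
             (simp add: monomial_update [OF coord(1)] monomial_split [OF coord(1), of \<beta>] mult_ac)
      next
        case False
        then have i: "i \<in> {1..<N}" using coord(1) by simp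
        moreover have "\<beta> i \<le> 4" using i \<beta> by (auto simp: reduced_exponents_def)
        ultimately have "\<beta> i = 4" using False by simp
        \<comment> \<open>The remaining exponents sum to at most \<open>d - 4\<close>, so after the
          substitution the degree is at most \<open>d\<close>, one below the bound
          \<open>Suc d\<close> of the product.\<close>
        have "polyfun N (4 + (\<Sum>j<N. (\<beta>(i := 0)) j)) (\<lambda>u. g i u * monomial N (\<beta>(i := 0)) u)"
          by (intro polyfun_mult g i polyfun_monomial)
        then have "polyfun N d (\<lambda>u. g i u * monomial N (\<beta>(i := 0)) u)"
          by (rule polyfun_mono) (use deg \<open>\<beta> i = 4\<close> sum_update [OF coord(1), of \<beta> 0] in simp)
        then have "lin_comb_on Z (reduced_exponents N d) (monomial N)
            (\<lambda>u. g i u * monomial N (\<beta>(i := 0)) u)"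
          by (rule coord.prems [OF lessI])
        then have "lin_comb_on Z (reduced_exponents N (Suc d)) (monomial N)
            (\<lambda>u. g i u * monomial N (\<beta>(i := 0)) u)"
          by (rule lin_comb_on_mono) (simp_all add: finite_reduced_exponents reduced_exponents_mono)
        then show ?thesis
        proof (rule lin_comb_on_cong)
          fix u assume "u \<in> Z"
          show "g i u * monomial N (\<beta>(i := 0)) u = u i * monomial N \<beta> u"
            unfolding Z [OF \<open>u \<in> Z\<close> i, symmetric] monomial_update [OF coord(1)]
              monomial_split [OF coord(1), of \<beta>] \<open>\<beta> i = 4\<close>
            by (simp add: eval_nat_numeral)
        qed
      qed
    qed
    have "lin_comb_on Z (reduced_exponents N (Suc d)) (monomial N)
        (\<lambda>u. \<Sum>\<beta>\<in>reduced_exponents N d. c \<beta> * (u i * monomial N \<beta> u))"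
      by (intro lin_comb_on_sum lin_comb_on_cmult step)
    then show ?case
      by (rule lin_comb_on_cong) (simp add: c sum_distrib_left mult_ac)
  qed
qed

text \<open>The \<open>(S + 1)\<^sup>2\<close> monomials in two coordinates have degree at most
  \<open>2 * S\<close> and reduce to combinations of at most
  \<open>(2 * S + 1) * 5 ^ (N - 1)\<close> monomials. Since \<open>5 ^ (N - 1) = S / 2\<close>, this
  is fewer, so they are dependent on \<open>Z\<close>.\<close>

lemma exists_bivariate_relation:
  assumes g: "\<And>i. i \<in> {1..<N} \<Longrightarrow> polyfun N 4 (g i)"
    and Z: "\<And>u i. u \<in> Z \<Longrightarrow> i \<in> {1..<N} \<Longrightarrow> u i ^ 5 = g i u"
    and j: "j < N"
  defines "S \<equiv> 2 * 5 ^ (N - 1)"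
  shows "\<exists>p :: nat \<Rightarrow> nat \<Rightarrow> real. (\<exists>a\<le>S. \<exists>b\<le>S. p a b \<noteq> 0) \<and>
    (\<forall>u\<in>Z. (\<Sum>a\<le>S. \<Sum>b\<le>S. p a b * u 0 ^ a * u j ^ b) = 0)"
proof -
  define I where "I = {..S} \<times> {..S}"
  define G where "G = reduced_exponents N (2 * S)"
  have "N > 0" using j by simp
  have "lin_comb_on Z G (monomial N) (\<lambda>u. u 0 ^ fst ab * u j ^ snd ab)" if "ab \<in> I" for ab
  proof -
    have "polyfun N (fst ab * 1 + snd ab * 1) (\<lambda>u. u 0 ^ fst ab * u j ^ snd ab)"
      by (intro polyfun_mult polyfun_power polyfun_proj j \<open>N > 0\<close>)
    then have "polyfun N (2 * S) (\<lambda>u. u 0 ^ fst ab * u j ^ snd ab)"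
      by (rule polyfun_mono) (use that in \<open>auto simp: I_def\<close>)
    then show ?thesis unfolding G_def by (intro polyfun_reduce [of N g] g Z)
  qed
  then have "\<forall>ab. \<exists>c. ab \<in> I \<longrightarrow> (\<forall>u\<in>Z. u 0 ^ fst ab * u j ^ snd ab = (\<Sum>\<beta>\<in>G. c \<beta> * monomial N \<beta> u))"
    by (auto simp: lin_comb_on_def)
  then obtain C where C: "\<And>ab u. ab \<in> I \<Longrightarrow> u \<in> Z \<Longrightarrow>
      u 0 ^ fst ab * u j ^ snd ab = (\<Sum>\<beta>\<in>G. C ab \<beta> * monomial N \<beta> u)"
    by metis
  have "card G \<le> (2 * S + 1) * 5 ^ (N - 1)"
    unfolding G_def by (rule card_reduced_exponents [OF \<open>N > 0\<close>])
  also have "\<dots> < (S + 1) * (S + 1)"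
    by (simp add: S_def algebra_simps)
  also have "\<dots> = card I" by (simp add: I_def)
  finally have "card G < card I" .
  then obtain c where c: "\<exists>ab\<in>I. c ab \<noteq> 0" "\<And>\<beta>. \<beta> \<in> G \<Longrightarrow> (\<Sum>ab\<in>I. c ab * C ab \<beta>) = 0"
    using exists_nontrivial_relation [of G I C] finite_reduced_exponents by (auto simp: G_def I_def)
  have "(\<Sum>a\<le>S. \<Sum>b\<le>S. c (a, b) * u 0 ^ a * u j ^ b) = 0" if "u \<in> Z" for u
  proof -
    have "(\<Sum>a\<le>S. \<Sum>b\<le>S. c (a, b) * u 0 ^ a * u j ^ b) = (\<Sum>ab\<in>I. c ab * (u 0 ^ fst ab * u j ^ snd ab))"
      by (simp add: I_def sum.cartesian_product case_prod_beta mult.assoc)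
    also have "\<dots> = (\<Sum>ab\<in>I. \<Sum>\<beta>\<in>G. c ab * C ab \<beta> * monomial N \<beta> u)"
      using C that by (intro sum.cong) (auto simp: sum_distrib_left mult.assoc)
    also have "\<dots> = (\<Sum>\<beta>\<in>G. (\<Sum>ab\<in>I. c ab * C ab \<beta>) * monomial N \<beta> u)"
      by (subst sum.swap) (simp add: sum_distrib_right)
    also have "\<dots> = 0" using c(2) by simp
    finally show ?thesis .
  qed
  then show ?thesis
    using c(1) by (intro exI [of _ "\<lambda>a b. c (a, b)"]) (auto simp: I_def)
qed

section \<open>Penalised minimisation\<close>

text \<open>Tychonoff's theorem in the topology of the function type.\<close>

lemma compact_Pi_UNIV:
  fixes X :: "'i \<Rightarrow> 'a::topological_space set"
  assumes "\<And>i. compact (X i)"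
  shows "compact {u. \<forall>i. u i \<in> X i}"
proof -
  have "compactin (product_topology (\<lambda>i. euclidean) UNIV) (PiE UNIV X)"
    using assms by (simp add: compactin_PiE)
  moreover have "PiE UNIV X = {u. \<forall>i. u i \<in> X i}" by (auto simp: PiE_iff)
  ultimately show ?thesis by (simp add: euclidean_product_topology)
qed

text \<open>Points are functions on all naturals; zeros from \<open>N\<close> on leave finitely many
  free coordinates, so bounding these gives a compact set.\<close>

definition slice :: "nat \<Rightarrow> real \<Rightarrow> (nat \<Rightarrow> real) set" where
  "slice N x = {u. u 0 = x \<and> u 1 = 1 \<and> (\<forall>i\<ge>N. u i = 0)}"

text \<open>The sixth powers make the minimisation coercive, and, the defect \<open>E\<close> having degree 4, they make
  every critical equation of the form \<open>u i ^ 5 =\<close> lower order terms.\<close>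

definition penalty ::
    "nat \<Rightarrow> ((nat \<Rightarrow> real) \<Rightarrow> real) \<Rightarrow> real \<Rightarrow> real \<Rightarrow> (nat \<Rightarrow> real) \<Rightarrow> real" where
  "penalty N E \<mu> A u = A * E u + \<mu> * (\<Sum>i\<in>{2..<N}. u i ^ 6) - u 2"

text \<open>The radius does not depend on the weight \<open>A\<close>, so a compact box can be fixed
  before \<open>A\<close> is chosen.\<close>

definition penalty_radius :: "real \<Rightarrow> real \<Rightarrow> real" where
  "penalty_radius \<mu> c = max 1 (2 * (c + max 1 (2 / \<mu>)) / \<mu>)"

text \<open>Half of the sixth-power term absorbs \<open>u 2\<close> up to the constant
  \<open>\<kappa>\<close>, because \<open>u 2 ^ 5 \<ge> 2 / \<mu>\<close> once
  \<open>u 2 \<ge> \<kappa>\<close>; the other half bounds every coordinate.\<close>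

lemma penalty_coercive:
  assumes "3 \<le> N" "\<mu> > 0" "A * E u \<ge> 0" and le: "penalty N E \<mu> A u \<le> c" and i: "i \<in> {2..<N}"
  shows "\<bar>u i\<bar> \<le> penalty_radius \<mu> c"
proof -
  define \<kappa> where "\<kappa> = max 1 (2 / \<mu>)"
  define s where "s = (\<Sum>i\<in>{2..<N}. u i ^ 6)"
  have ge_self: "t \<le> t ^ 6" if "1 \<le> t" for t :: real
    using that self_le_power [of t 6] by simp
  have le_s: "u j ^ 6 \<le> s" if "j \<in> {2..<N}" for j
    unfolding s_def using that by (intro member_le_sum) auto
  have "u 2 \<le> \<mu> / 2 * u 2 ^ 6 + \<kappa>"
  proof (cases "u 2 \<le> \<kappa>")
    case True
    have "0 \<le> \<mu> / 2 * u 2 ^ 6" using \<open>\<mu> > 0\<close> by simp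
    with True show ?thesis by simp
  next
    case False
    then have "1 \<le> u 2" and "2 / \<mu> \<le> u 2" by (auto simp: \<kappa>_def)
    then have "2 / \<mu> \<le> u 2 ^ 5" using self_le_power [of "u 2" 5] by simp
    then have "1 \<le> \<mu> / 2 * u 2 ^ 5" using \<open>\<mu> > 0\<close> by (simp add: field_simps)
    then have "1 * u 2 \<le> \<mu> / 2 * u 2 ^ 5 * u 2"
      using \<open>1 \<le> u 2\<close> by (intro mult_right_mono) auto
    moreover have "0 \<le> \<kappa>" by (simp add: \<kappa>_def)
    ultimately show ?thesis by (simp add: eval_nat_numeral)
  qed
  also have "\<dots> \<le> \<mu> / 2 * s + \<kappa>"
    using le_s [of 2] assms by (intro add_right_mono mult_left_mono) auto
  finally have "\<mu> * s - u 2 \<ge> \<mu> / 2 * s - \<kappa>" by simp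
  moreover have "\<mu> * s - u 2 \<le> c"
    using le assms(3) by (simp add: penalty_def s_def)
  ultimately have "s \<le> 2 * (c + \<kappa>) / \<mu>"
    using \<open>\<mu> > 0\<close> by (simp add: field_simps)
  then have "\<bar>u i\<bar> ^ 6 \<le> 2 * (c + \<kappa>) / \<mu>"
    using le_s [OF i] by simp
  then show ?thesis
    using ge_self [of "\<bar>u i\<bar>"] unfolding penalty_radius_def \<kappa>_def [symmetric] by linarith
qed

definition slice_box :: "nat \<Rightarrow> real \<Rightarrow> real \<Rightarrow> (nat \<Rightarrow> real) set" where
  "slice_box N x R = {u \<in> slice N x. \<forall>i\<in>{2..<N}. \<bar>u i\<bar> \<le> R}"

lemma compact_slice_box:
  assumes "3 \<le> N"
  shows "compact (slice_box N x R)"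
proof -
  define X :: "nat \<Rightarrow> real set" where
    "X i = (if i = 0 then {x} else if i = 1 then {1} else if i < N then {-R..R} else {0})" for i
  have "slice_box N x R = {u. \<forall>i. u i \<in> X i}"
  proof (intro set_eqI iffI)
    fix u assume u: "u \<in> {u. \<forall>i. u i \<in> X i}"
    have "u 0 = x" "u 1 = 1" using u by (auto simp: X_def dest: spec [of _ 0] spec [of _ 1])
    moreover have "u i = 0" if "i \<ge> N" for i
      using u that assms by (auto simp: X_def dest: spec [of _ i])
    moreover have "\<bar>u i\<bar> \<le> R" if "i \<in> {2..<N}" for i
      using u that by (auto simp: X_def abs_le_iff dest!: spec [of _ i])
    ultimately show "u \<in> slice_box N x R" by (simp add: slice_box_def slice_def)
  next
    fix u assume "u \<in> slice_box N x R"
    then show "u \<in> {u. \<forall>i. u i \<in> X i}"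
      by (auto simp: X_def slice_box_def slice_def abs_le_iff not_less_eq_eq minus_le_iff
          numeral_2_eq_2)
  qed
  also have "compact \<dots>" by (rule compact_Pi_UNIV) (simp add: X_def)
  finally show ?thesis .
qed

lemma continuous_on_penalty:
  assumes "polyfun N d E"
  shows "continuous_on S (penalty N E \<mu> A)"
  unfolding penalty_def
  by (intro continuous_intros polyfun_continuous_on [OF assms]
      continuous_on_subset [OF continuous_on_product_coordinates subset_UNIV])

text \<open>The box contains every point of the slice that does at least as well as
  \<open>v\<close>, so a minimum over the compact box is one over the slice.\<close>

lemma penalty_has_minimiser:
  assumes "3 \<le> N" "\<mu> > 0" "A \<ge> 0" "polyfun N d E" "\<And>u. E u \<ge> 0" and v: "v \<in> slice N x"
  obtains u where "u \<in> slice N x" "\<And>w. w \<in> slice N x \<Longrightarrow> penalty N E \<mu> A u \<le> penalty N E \<mu> A w"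
proof -
  define c where "c = penalty N E \<mu> A v"
  define box where "box = slice_box N x (penalty_radius \<mu> c)"
  have in_box: "w \<in> box" if "w \<in> slice N x" "penalty N E \<mu> A w \<le> c" for w
    using penalty_coercive [OF assms(1,2) _ that(2)] that assms
    by (auto simp: box_def slice_box_def)
  then have "v \<in> box" using v by (auto simp: c_def)
  then obtain u where u: "u \<in> box" "\<And>w. w \<in> box \<Longrightarrow> penalty N E \<mu> A u \<le> penalty N E \<mu> A w"
    using continuous_attains_inf [of box "penalty N E \<mu> A"] compact_slice_box [OF assms(1)]
      continuous_on_penalty [OF assms(4)] by (force simp: box_def)
  have "penalty N E \<mu> A u \<le> penalty N E \<mu> A w" if "w \<in> slice N x" for w
    using u(2) [of w] u(2) [OF \<open>v \<in> box\<close>] in_box [OF that] by (fastforce simp: c_def)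
  with u(1) show ?thesis by (intro that) (auto simp: box_def slice_box_def)
qed

text \<open>Comparison with \<open>v\<close> gives the lower bound. For the upper one,
  \<open>E\<close> is positive on the compact part of the box where
  \<open>u 2 \<ge> Y + 1 / 2\<close>, hence bounded below by some \<open>e > 0\<close> there, and a
  large \<open>A\<close> makes such points too expensive.\<close>

lemma penalty_minimiser_coordinate:
  assumes "3 \<le> N" "\<mu> > 0" "polyfun N d E" "\<And>u. E u \<ge> 0"
    and v: "v \<in> slice N x" "E v = 0" "\<mu> * (\<Sum>i\<in>{2..<N}. v i ^ 6) \<le> 1 / 2"
    and bound: "\<forall>u\<in>slice N x. E u = 0 \<longrightarrow> u 2 \<le> Y"
  obtains A\<^sub>0 where "A\<^sub>0 \<ge> 0" "\<And>A u. A\<^sub>0 \<le> A \<Longrightarrow> u \<in> slice N x \<Longrightarrow>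
      penalty N E \<mu> A u \<le> penalty N E \<mu> A v \<Longrightarrow> v 2 - 1 / 2 \<le> u 2 \<and> u 2 \<le> Y + 1 / 2"
proof -
  define c where "c = 1 / 2 - v 2"
  define R where "R = penalty_radius \<mu> c"
  define T where "T = slice_box N x R \<inter> {u. Y + 1 / 2 \<le> u 2}"
  have c: "penalty N E \<mu> A v \<le> c" for A
    using v by (simp add: penalty_def c_def)
  have "closed {u :: nat \<Rightarrow> real. Y + 1 / 2 \<le> u 2}"
    by (intro closed_Collect_le continuous_intros continuous_on_product_coordinates)
  then have "compact T"
    unfolding T_def by (intro compact_Int_closed compact_slice_box assms)
  have "\<exists>e>0. \<forall>u\<in>T. e \<le> E u"
  proof (cases "T = {}")
    case False
    obtain u where u: "u \<in> T" "\<And>w. w \<in> T \<Longrightarrow> E u \<le> E w"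
      using continuous_attains_inf [OF \<open>compact T\<close> False polyfun_continuous_on [OF assms(3)]] by blast
    have "E u \<noteq> 0" using bound u(1) by (auto simp: T_def slice_box_def)
    with assms(4) [of u] have "E u > 0" by simp
    with u(2) show ?thesis by blast
  qed (auto intro: exI [of _ 1])
  then obtain e where e: "e > 0" "\<And>u. u \<in> T \<Longrightarrow> e \<le> E u" by blast
  \<comment> \<open>Then \<open>A\<^sub>0 * e\<close> exceeds \<open>c + u 2\<close> throughout the
    box, where \<open>u 2 \<le> R\<close>.\<close>
  define A\<^sub>0 where "A\<^sub>0 = (\<bar>c\<bar> + \<bar>R\<bar> + 1) / e"
  have "A\<^sub>0 \<ge> 0" using e by (simp add: A\<^sub>0_def)
  moreover have "v 2 - 1 / 2 \<le> u 2 \<and> u 2 \<le> Y + 1 / 2"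
    if A: "A\<^sub>0 \<le> A" and u: "u \<in> slice N x" "penalty N E \<mu> A u \<le> penalty N E \<mu> A v" for A u
  proof -
    have "0 \<le> A * E u" using A \<open>A\<^sub>0 \<ge> 0\<close> assms(4) by simp
    have "penalty N E \<mu> A u \<le> c" using u(2) c [of A] by simp
    have "0 \<le> \<mu> * (\<Sum>i\<in>{2..<N}. u i ^ 6)"
      using assms(2) by (intro mult_nonneg_nonneg sum_nonneg) auto
    then have pen: "A * E u - u 2 \<le> c"
      using \<open>penalty N E \<mu> A u \<le> c\<close> by (simp add: penalty_def)
    have uR: "\<bar>u i\<bar> \<le> R" if "i \<in> {2..<N}" for i
      using penalty_coercive [OF assms(1,2) \<open>0 \<le> A * E u\<close> \<open>penalty N E \<mu> A u \<le> c\<close> that]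
      by (simp add: R_def)
    have "u 2 \<le> Y + 1 / 2"
    proof (rule ccontr)
      assume "\<not> ?thesis"
      then have "u \<in> T" using u uR by (simp add: T_def slice_box_def)
      have "\<bar>c\<bar> + \<bar>R\<bar> + 1 = A\<^sub>0 * e" using e by (simp add: A\<^sub>0_def)
      also have "\<dots> \<le> A * E u"
        using A e \<open>u \<in> T\<close> \<open>A\<^sub>0 \<ge> 0\<close> by (intro mult_mono) auto
      also have "\<dots> \<le> c + u 2" using pen by simp
      also have "\<dots> \<le> \<bar>c\<bar> + \<bar>R\<bar>" using uR [of 2] assms(1) by simp
      finally show False by simp
    qed
    with pen \<open>0 \<le> A * E u\<close> show ?thesis by (simp add: c_def)
  qed
  ultimately show ?thesis by (rule that)
qed

text \<open>The slice pins coordinates 0 and 1 but lets each \<open>i\<close> in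
  \<open>{2..<N}\<close> vary freely, so the partial derivative of the penalty vanishes
  there.\<close>

lemma penalty_minimiser_critical:
  assumes "\<And>u. ((\<lambda>s. E (u(i := s))) has_real_derivative g u) (at (u i))"
    and u: "u \<in> slice N x" and i: "i \<in> {2..<N}"
    and min: "\<And>w. w \<in> slice N x \<Longrightarrow> penalty N E \<mu> A u \<le> penalty N E \<mu> A w"
  shows "A * g u + 6 * \<mu> * u i ^ 5 - (if i = 2 then 1 else 0) = 0"
proof -
  define S where "S = (\<Sum>j\<in>{2..<N} - {i}. u j ^ 6)"
  define c :: real where "c = (if i = 2 then 1 else 0)"
  have pen: "penalty N E \<mu> A (u(i := s)) = A * E (u(i := s)) + \<mu> * (s ^ 6 + S) - (u(i := s)) 2" for s
  proof -
    have "(\<Sum>j\<in>{2..<N}. (u(i := s)) j ^ 6) = s ^ 6 + (\<Sum>j\<in>{2..<N} - {i}. (u(i := s)) j ^ 6)"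
      using i by (subst sum.remove [of _ i]) auto
    also have "(\<Sum>j\<in>{2..<N} - {i}. (u(i := s)) j ^ 6) = S"
      unfolding S_def by (intro sum.cong) auto
    finally show ?thesis by (simp add: penalty_def)
  qed
  have "((\<lambda>s. (u(i := s)) 2) has_real_derivative c) (at (u i))"
    by (cases "i = 2") (auto simp: c_def)
  then have "((\<lambda>s. A * E (u(i := s)) + \<mu> * (s ^ 6 + S) - (u(i := s)) 2) has_real_derivative
      A * g u + \<mu> * (6 * u i ^ 5) - c) (at (u i))"
    by (intro DERIV_diff DERIV_add DERIV_cmult assms(1)) (auto intro!: derivative_eq_intros)
  then have "A * g u + \<mu> * (6 * u i ^ 5) - c = 0"
  proof (rule DERIV_local_min [of _ _ _ 1])
    show "\<forall>s. \<bar>u i - s\<bar> < 1 \<longrightarrow> A * E (u(i := u i)) + \<mu> * (u i ^ 6 + S) - (u(i := u i)) 2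
        \<le> A * E (u(i := s)) + \<mu> * (s ^ 6 + S) - (u(i := s)) 2"
    proof (intro allI impI)
      fix s
      have "u(i := s) \<in> slice N x" using u i by (auto simp: slice_def)
      then have "penalty N E \<mu> A (u(i := u i)) \<le> penalty N E \<mu> A (u(i := s))"
        using min by simp
      then show "A * E (u(i := u i)) + \<mu> * (u i ^ 6 + S) - (u(i := u i)) 2
        \<le> A * E (u(i := s)) + \<mu> * (s ^ 6 + S) - (u(i := s)) 2"
        by (simp only: pen)
    qed
  qed simp
  then show ?thesis by (simp add: c_def mult_ac)
qed

text \<open>A single \<open>\<mu>\<close> and a single \<open>A\<close> serve all finitely many
  \<open>k\<close>, so the critical equations are the same for every sample; \<open>x k\<close>
  enters only through \<open>u 0\<close>.\<close>

lemma exists_critical_system: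
  fixes K :: nat
  assumes N: "3 \<le> N" and E: "polyfun N 4 E" "\<And>u. E u \<ge> 0"
    and v: "\<And>k. k \<le> K \<Longrightarrow> v k \<in> slice N (x k)" "\<And>k. k \<le> K \<Longrightarrow> E (v k) = 0"
    and bound: "\<And>k u. k \<le> K \<Longrightarrow> u \<in> slice N (x k) \<Longrightarrow> E u = 0 \<Longrightarrow> u 2 \<le> Y k"
  shows "\<exists>g. (\<forall>i\<in>{1..<N}. polyfun N 4 (g i)) \<and>
    (\<forall>k\<le>K. \<exists>u. u 0 = x k \<and> v k 2 - 1 / 2 \<le> u 2 \<and> u 2 \<le> Y k + 1 / 2 \<and>
       (\<forall>i\<in>{1..<N}. u i ^ 5 = g i u))"
proof -
  define s where "s k = (\<Sum>i\<in>{2..<N}. v k i ^ 6)" for k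
  \<comment> \<open>Bounding each \<open>s k\<close> by the sum of all of them gives
    \<open>\<mu> * s k \<le> 1 / 2\<close> for every \<open>k\<close> at once.\<close>
  define \<mu> where "\<mu> = 1 / (2 * (1 + (\<Sum>k\<le>K. s k)))"
  have s_nonneg: "0 \<le> s k" for k unfolding s_def by (intro sum_nonneg) auto
  then have sum_s: "0 \<le> (\<Sum>k\<le>K. s k)" by (intro sum_nonneg)
  then have "\<mu> > 0" by (simp add: \<mu>_def)
  have \<mu>_s: "\<mu> * s k \<le> 1 / 2" if "k \<le> K" for k
  proof -
    have "s k \<le> (\<Sum>k\<le>K. s k)" using that s_nonneg by (intro member_le_sum) auto
    then show ?thesis using sum_s by (simp add: \<mu>_def divide_simps)
  qed
  have "\<forall>k. \<exists>A\<^sub>0\<ge>0. k \<le> K \<longrightarrow> (\<forall>A u. A\<^sub>0 \<le> A \<longrightarrow> u \<in> slice N (x k) \<longrightarrow>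
      penalty N E \<mu> A u \<le> penalty N E \<mu> A (v k) \<longrightarrow> v k 2 - 1 / 2 \<le> u 2 \<and> u 2 \<le> Y k + 1 / 2)"
  proof
    fix k
    show "\<exists>A\<^sub>0\<ge>0. k \<le> K \<longrightarrow> (\<forall>A u. A\<^sub>0 \<le> A \<longrightarrow> u \<in> slice N (x k) \<longrightarrow>
      penalty N E \<mu> A u \<le> penalty N E \<mu> A (v k) \<longrightarrow> v k 2 - 1 / 2 \<le> u 2 \<and> u 2 \<le> Y k + 1 / 2)"
    proof (cases "k \<le> K")
      case True
      then have "\<forall>u\<in>slice N (x k). E u = 0 \<longrightarrow> u 2 \<le> Y k"
        using bound by blast
      from penalty_minimiser_coordinate [of N \<mu> 4 E "v k" "x k" "Y k", OF N \<open>\<mu> > 0\<close> E v(1) [OF True] v(2) [OF True]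
          \<mu>_s [OF True, unfolded s_def] this]
      show ?thesis by metis
    qed auto
  qed
  then obtain A\<^sub>0 where A\<^sub>0: "\<And>k. A\<^sub>0 k \<ge> 0"
    and coord: "\<And>k A u. k \<le> K \<Longrightarrow> A\<^sub>0 k \<le> A \<Longrightarrow> u \<in> slice N (x k) \<Longrightarrow>
      penalty N E \<mu> A u \<le> penalty N E \<mu> A (v k) \<Longrightarrow> v k 2 - 1 / 2 \<le> u 2 \<and> u 2 \<le> Y k + 1 / 2"
    by metis
  define A where "A = (\<Sum>k\<le>K. A\<^sub>0 k)"
  have "A \<ge> 0" unfolding A_def by (intro sum_nonneg A\<^sub>0)
  have A\<^sub>0_le: "A\<^sub>0 k \<le> A" if "k \<le> K" for k
    unfolding A_def using that A\<^sub>0 by (intro member_le_sum) auto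
  obtain D where D: "\<And>i. polyfun N 3 (D i)"
    and der: "\<And>i u. ((\<lambda>s. E (u(i := s))) has_real_derivative D i u) (at (u i))"
    using polyfun_has_partial_derivative [OF E(1)] by (simp; metis)
  \<comment> \<open>For \<open>i \<ge> 2\<close> this solves the critical equation for
    \<open>u i ^ 5\<close>. The fixed coordinate \<open>u 1 = 1\<close> is written as
    \<open>u 1 ^ 5 = 1\<close>, so that only coordinate 0 stays a parameter.\<close>
  define g where "g i u = (if i = 1 then 1
      else (1 / (6 * \<mu>)) * ((if i = 2 then 1 else 0) - A * D i u))" for i u
  have "polyfun N 4 (g i)" for i
  proof (cases "i = 1")
    case True
    then show ?thesis by (simp add: g_def [abs_def] polyfun.const)
  next
    case False
    have "polyfun N 4 (\<lambda>u. (1 / (6 * \<mu>)) * ((if i = 2 then 1 else 0) - A * D i u))"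
      by (intro polyfun_cmult polyfun_diff polyfun.const polyfun_mono [OF D]) simp
    with False show ?thesis by (simp add: g_def [abs_def])
  qed
  moreover have "\<exists>u. u 0 = x k \<and> v k 2 - 1 / 2 \<le> u 2 \<and> u 2 \<le> Y k + 1 / 2 \<and>
       (\<forall>i\<in>{1..<N}. u i ^ 5 = g i u)" if k: "k \<le> K" for k
  proof -
    obtain u where u: "u \<in> slice N (x k)"
      and min: "\<And>w. w \<in> slice N (x k) \<Longrightarrow> penalty N E \<mu> A u \<le> penalty N E \<mu> A w"
      using penalty_has_minimiser [of N \<mu> A 4 E "v k" "x k", OF N \<open>\<mu> > 0\<close> \<open>A \<ge> 0\<close> E v(1) [OF k]] by blast
    have "u i ^ 5 = g i u" if "i \<in> {1..<N}" for i
    proof (cases "i = 1")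
      case True
      then show ?thesis using u by (simp add: g_def slice_def)
    next
      case False
      with that have "i \<in> {2..<N}" by simp
      from penalty_minimiser_critical [OF der u this min] False \<open>\<mu> > 0\<close>
      show ?thesis by (simp add: g_def field_simps)
    qed
    moreover have "u 0 = x k" using u by (simp add: slice_def)
    moreover have "v k 2 - 1 / 2 \<le> u 2 \<and> u 2 \<le> Y k + 1 / 2"
      using coord [OF k A\<^sub>0_le [OF k] u] min v(1) [OF k] by blast
    ultimately show ?thesis by blast
  qed
  ultimately show ?thesis by blast
qed

section \<open>Second-order conic systems\<close>

definition conic_form ::
    "nat \<Rightarrow> (nat \<Rightarrow> nat \<Rightarrow> nat \<Rightarrow> real) \<Rightarrow> (nat \<Rightarrow> nat \<Rightarrow> real) \<Rightarrow> nat \<Rightarrow> nat \<Rightarrow> (nat \<Rightarrow> real) \<Rightarrow> real" where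
  "conic_form n a b j l u = affine_form n (a j l) (b j l) u"

text \<open>Coordinates \<open>n + j\<close> and \<open>n + m + j\<close> are slack variables: a triple \<open>y\<close> lies in the Lorentz cone iff
  \<open>y\<^sub>3\<close> and \<open>y\<^sub>3\<^sup>2 - y\<^sub>1\<^sup>2 - y\<^sub>2\<^sup>2\<close> are both squares.\<close>

definition conic_defect ::
    "nat \<Rightarrow> nat \<Rightarrow> (nat \<Rightarrow> nat \<Rightarrow> nat \<Rightarrow> real) \<Rightarrow> (nat \<Rightarrow> nat \<Rightarrow> real) \<Rightarrow> (nat \<Rightarrow> real) \<Rightarrow> real" where
  "conic_defect n m a b u =
     (\<Sum>j<m. (conic_form n a b j 3 u - u (n + j) ^ 2) ^ 2 +
       (conic_form n a b j 3 u ^ 2 - conic_form n a b j 1 u ^ 2 - conic_form n a b j 2 u ^ 2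
          - u (n + m + j) ^ 2) ^ 2)"

lemma conic_defect_nonneg: "0 \<le> conic_defect n m a b u"
  unfolding conic_defect_def by (intro sum_nonneg) simp

lemma polyfun_conic_defect: "polyfun (n + 2 * m) 4 (conic_defect n m a b)"
proof -
  let ?N = "n + 2 * m"
  have sq4: "polyfun ?N 4 (\<lambda>u. f u ^ 2)" if "polyfun ?N 2 f" for f
    using polyfun_power [OF that, of 2] by simp
  have sq2: "polyfun ?N 2 (\<lambda>u. f u ^ 2)" if "polyfun ?N 1 f" for f
    using polyfun_power [OF that, of 2] by simp
  have form: "polyfun ?N 1 (conic_form n a b j l)" for j l
    unfolding conic_form_def [abs_def] affine_form_def
    by (intro polyfun.add polyfun_sum polyfun_cmult polyfun_proj polyfun.const) auto
  show ?thesis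
    unfolding conic_defect_def [abs_def]
    by (intro polyfun_sum polyfun.add sq4 polyfun_diff sq2 form polyfun_proj polyfun_mono [OF form]) auto
qed

lemma conic_defect_eq_0_imp:
  assumes "u \<in> slice N x" "conic_defect n m a b u = 0"
  shows "(x, 1, u 2) \<in> conic_projection n m a b"
proof -
  have "(conic_form n a b j 1 u, conic_form n a b j 2 u, conic_form n a b j 3 u) \<in> lorentz3"
    if "j < m" for j
  proof -
    have "(conic_form n a b j 3 u - u (n + j) ^ 2) ^ 2 +
       (conic_form n a b j 3 u ^ 2 - conic_form n a b j 1 u ^ 2 - conic_form n a b j 2 u ^ 2
          - u (n + m + j) ^ 2) ^ 2 = 0"
      using assms(2) that unfolding conic_defect_def
      by (subst (asm) sum_nonneg_eq_0_iff) (simp_all del: sum_power2_eq_zero_iff)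
    then have "conic_form n a b j 3 u = u (n + j) ^ 2"
      "conic_form n a b j 3 u ^ 2 - conic_form n a b j 1 u ^ 2 - conic_form n a b j 2 u ^ 2
          = u (n + m + j) ^ 2"
      unfolding sum_power2_eq_zero_iff right_minus_eq by blast+
    then have "0 \<le> conic_form n a b j 3 u"
      "conic_form n a b j 1 u ^ 2 + conic_form n a b j 2 u ^ 2 \<le> conic_form n a b j 3 u ^ 2"
      by (simp, smt (verit) zero_le_power2)
    then show ?thesis by (simp add: lorentz3_def real_le_lsqrt)
  qed
  then show ?thesis
    using assms(1) by (auto simp: conic_projection_def conic_form_def slice_def intro!: exI [of _ u])
qed

lemma conic_projection_imp_defect_0:
  assumes "3 \<le> n" "(x, 1, y) \<in> conic_projection n m a b"
  obtains v where "v \<in> slice (n + 2 * m) x" "conic_defect n m a b v = 0" "v 2 = y"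
proof -
  obtain w where w: "w 0 = x" "w 1 = 1" "w 2 = y"
    and cone: "\<And>j. j < m \<Longrightarrow>
      (conic_form n a b j 1 w, conic_form n a b j 2 w, conic_form n a b j 3 w) \<in> lorentz3"
    using assms(2) by (auto simp: conic_projection_def conic_form_def)
  \<comment> \<open>The first \<open>n\<close> entries are those of \<open>w\<close>, so the affine
    forms keep their values; the slacks are the square roots of the two nonnegative
    quantities.\<close>
  define v where "v i = (if i < n then w i
      else if i < n + m then sqrt (conic_form n a b (i - n) 3 w)
      else if i < n + 2 * m then sqrt (conic_form n a b (i - n - m) 3 w ^ 2
        - conic_form n a b (i - n - m) 1 w ^ 2 - conic_form n a b (i - n - m) 2 w ^ 2)
      else 0)" for i
  have form: "conic_form n a b j l v = conic_form n a b j l w" for j l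
    by (simp add: conic_form_def affine_form_def v_def)
  have nonneg: "0 \<le> conic_form n a b j 3 w"
    "0 \<le> conic_form n a b j 3 w ^ 2 - conic_form n a b j 1 w ^ 2 - conic_form n a b j 2 w ^ 2"
    if "j < m" for j
  proof -
    have le: "sqrt (conic_form n a b j 1 w ^ 2 + conic_form n a b j 2 w ^ 2) \<le> conic_form n a b j 3 w"
      using cone [OF that] by (simp add: lorentz3_def)
    then show "0 \<le> conic_form n a b j 3 w"
      by (rule order_trans [rotated]) simp
    from sqrt_le_D [OF le]
    show "0 \<le> conic_form n a b j 3 w ^ 2 - conic_form n a b j 1 w ^ 2 - conic_form n a b j 2 w ^ 2"
      by simp
  qed
  have "conic_defect n m a b v = 0"
    unfolding conic_defect_def form
  proof (intro sum.neutral ballI)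
    fix j assume "j \<in> {..<m}"
    then have "j < m" by simp
    then have "v (n + j) ^ 2 = conic_form n a b j 3 w"
      "v (n + m + j) ^ 2 = conic_form n a b j 3 w ^ 2
        - conic_form n a b j 1 w ^ 2 - conic_form n a b j 2 w ^ 2"
      using nonneg by (simp_all add: v_def)
    then show "(conic_form n a b j 3 w - v (n + j) ^ 2) ^ 2 +
       (conic_form n a b j 3 w ^ 2 - conic_form n a b j 1 w ^ 2 - conic_form n a b j 2 w ^ 2
          - v (n + m + j) ^ 2) ^ 2 = 0"
      by simp
  qed
  moreover have "v \<in> slice (n + 2 * m) x" "v 2 = y"
    using w assms(1) by (auto simp: slice_def v_def)
  ultimately show ?thesis using that by blast
qed

section \<open>The lower bound on the size\<close>

text \<open>If \<open>ln M\<close> were larger, all points \<open>exp (B * k)\<close> with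
  \<open>k \<le> K\<close> would lie in \<open>[1, M]\<close>, and the relation from elimination
  would contradict its impossibility near the logarithm.\<close>

lemma ln_less_of_conic_approx:
  fixes n m :: nat and a b and M \<epsilon> :: real
  defines "S \<equiv> 2 * 5 ^ (n + 2 * m - 1)" and "C \<equiv> conic_projection n m a b"
  assumes n: "3 \<le> n" and M: "M > 1" and eps: "\<epsilon> \<le> 1"
    and inner: "Kexp M (-\<epsilon>) \<subseteq> C" and outer: "C \<subseteq> Kexp M \<epsilon>"
  shows "ln M < (8 * real S + 20) * real (2 * (S + 1)\<^sup>2)"
proof (rule ccontr)
  assume large: "\<not> ?thesis"
  define B where "B = 8 * real S + 20"
  define K where "K = 2 * (S + 1)\<^sup>2"
  define N where "N = n + 2 * m"
  have "N \<ge> 3" using n by (simp add: N_def)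
  have BK: "B * K \<le> ln M"
    using large unfolding B_def K_def by linarith
  have feas: "\<exists>v. v \<in> slice N (exp (B * k)) \<and> conic_defect n m a b v = 0 \<and> v 2 = B * k - \<epsilon>"
    if "k \<le> K" for k :: nat
  proof -
    have "0 \<le> B * k" by (simp add: B_def)
    have "B * k \<le> B * K" using that by (intro mult_left_mono) (auto simp: B_def)
    then have "exp (B * k) \<le> M"
      using BK M by (metis exp_le_cancel_iff exp_ln less_trans zero_less_one order_trans)
    moreover have "1 / M \<le> 1" using M by simp
    moreover have "1 \<le> exp (B * k)" using \<open>0 \<le> B * k\<close> by simp
    \<comment> \<open>The defining inequality of the inner set holds here with equality.\<close>
    ultimately have "(exp (B * k), 1, B * k - \<epsilon>) \<in> Kexp M (-\<epsilon>)"
      using M order_trans [of "1 / M" 1 "exp (B * k)"] by (simp add: Kexp_def)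
    then have "(exp (B * k), 1, B * k - \<epsilon>) \<in> conic_projection n m a b"
      using inner by (auto simp: C_def)
    from conic_projection_imp_defect_0 [OF n this] show ?thesis unfolding N_def by metis
  qed
  then obtain v where v: "\<And>k. k \<le> K \<Longrightarrow> v k \<in> slice N (exp (B * real k))"
    "\<And>k. k \<le> K \<Longrightarrow> conic_defect n m a b (v k) = 0" "\<And>k. k \<le> K \<Longrightarrow> v k 2 = B * k - \<epsilon>"
    by metis
  have bound: "u 2 \<le> B * k + \<epsilon>"
    if "u \<in> slice N (exp (B * k))" "conic_defect n m a b u = 0" for u and k :: nat
  proof -
    have "(exp (B * k), 1, u 2) \<in> Kexp M \<epsilon>"
      using conic_defect_eq_0_imp [OF that] outer by (auto simp: C_def)
    then show ?thesis by (simp add: Kexp_def)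
  qed
  have "\<exists>g. (\<forall>i\<in>{1..<N}. polyfun N 4 (g i)) \<and> (\<forall>k\<le>K. \<exists>u. u 0 = exp (B * k) \<and>
      v k 2 - 1 / 2 \<le> u 2 \<and> u 2 \<le> (B * k + \<epsilon>) + 1 / 2 \<and> (\<forall>i\<in>{1..<N}. u i ^ 5 = g i u))"
    by (rule exists_critical_system [OF \<open>N \<ge> 3\<close> polyfun_conic_defect [of n m a b, folded N_def]
          conic_defect_nonneg]) (use v bound in auto)
  then obtain g where g: "\<And>i. i \<in> {1..<N} \<Longrightarrow> polyfun N 4 (g i)"
    and ex_u: "\<And>k. k \<le> K \<Longrightarrow> \<exists>u. u 0 = exp (B * k) \<and> v k 2 - 1 / 2 \<le> u 2 \<and>
      u 2 \<le> (B * k + \<epsilon>) + 1 / 2 \<and> (\<forall>i\<in>{1..<N}. u i ^ 5 = g i u)"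
    by blast
  define Z where "Z = {u. \<forall>i\<in>{1..<N}. u i ^ 5 = g i u}"
  obtain u where u: "\<And>k. k \<le> K \<Longrightarrow> u k \<in> Z" "\<And>k. k \<le> K \<Longrightarrow> u k 0 = exp (B * real k)"
    "\<And>k. k \<le> K \<Longrightarrow> v k 2 - 1 / 2 \<le> u k 2" "\<And>k. k \<le> K \<Longrightarrow> u k 2 \<le> B * k + \<epsilon> + 1 / 2"
    using ex_u unfolding Z_def mem_Collect_eq by metis
  obtain p :: "nat \<Rightarrow> nat \<Rightarrow> real" where p: "\<exists>a\<le>S. \<exists>b\<le>S. p a b \<noteq> 0"
    and rel: "\<And>w. w \<in> Z \<Longrightarrow> (\<Sum>a\<le>S. \<Sum>b\<le>S. p a b * w 0 ^ a * w 2 ^ b) = 0"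
    using exists_bivariate_relation [of N g Z 2] g \<open>N \<ge> 3\<close> unfolding Z_def S_def N_def by auto
  have "p c d = 0" if "c \<le> S" "d \<le> S" for c d
  proof (rule no_bivariate_relation_near_log [of S K "\<lambda>k. u k 2" p, OF _ _ _ that])
    show "2 * (S + 1)\<^sup>2 \<le> K" by (simp add: K_def)
    fix k assume "k \<le> K"
    \<comment> \<open>The error is at most \<open>\<epsilon> + 1 / 2\<close>, which is below
      2.\<close>
    from u(3,4) [OF this] v(3) [OF this] eps
    show "\<bar>u k 2 - (8 * real S + 20) * real k\<bar> \<le> 2" unfolding B_def by linarith
    from rel [OF u(1) [OF \<open>k \<le> K\<close>]] u(2) [OF \<open>k \<le> K\<close>]
    show "(\<Sum>a\<le>S. \<Sum>b\<le>S. p a b * exp ((8 * real S + 20) * real k) ^ a * u k 2 ^ b) = 0"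
      by (simp add: B_def)
  qed
  with p show False by blast
qed

text \<open>As \<open>n + 2 * m \<le> 2 * q\<close>, the bound on \<open>ln M\<close> is a cubic in
  \<open>Q = 25 ^ q\<close> with constant \<open>36 * 2 * 9 \<le> 25 ^ 3\<close>, and
  \<open>q \<ge> 3\<close> absorbs this constant into the exponent \<open>4 * q\<close>.\<close>

lemma ln_ln_le_of_conic_approx:
  assumes "second_order_conic_approx q C" "M > 1" "\<epsilon> \<le> 1" "Kexp M (-\<epsilon>) \<subseteq> C" "C \<subseteq> Kexp M \<epsilon>"
  shows "3 \<le> q" "ln (ln M) \<le> 4 * ln 25 * real q"
proof -
  obtain n m a b where nm: "3 \<le> n" "n + m = q" and C: "C = conic_projection n m a b"
    using assms(1) by (auto simp: second_order_conic_approx_def)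
  show "3 \<le> q" using nm by simp
  define S :: nat where "S = 2 * 5 ^ (n + 2 * m - 1)"
  define Q :: nat where "Q = 25 ^ q"
  have "(5::nat) ^ (n + 2 * m - 1) \<le> 5 ^ (2 * q)"
    using nm by (intro power_increasing) auto
  also have "\<dots> = Q" by (simp add: Q_def power_mult)
  finally have "S \<le> 2 * Q" by (simp add: S_def)
  moreover have "1 \<le> Q" by (simp add: Q_def)
  ultimately have "(8 * S + 20) * (2 * (S + 1)\<^sup>2) \<le> (36 * Q) * (2 * (3 * Q)\<^sup>2)"
    by (intro mult_mono power_mono) auto
  also have "\<dots> \<le> 25 ^ 3 * Q ^ 3"
    by (simp add: power2_eq_square power3_eq_cube)
  also have "\<dots> = 25 ^ (3 + 3 * q)"
    by (simp add: Q_def power_add power_mult [symmetric] mult.commute)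
  also have "\<dots> \<le> 25 ^ (4 * q)"
    using \<open>3 \<le> q\<close> by (intro power_increasing) auto
  finally have "real ((8 * S + 20) * (2 * (S + 1)\<^sup>2)) \<le> real (25 ^ (4 * q))"
    by (simp only: of_nat_le_iff)
  moreover have "ln M < (8 * real S + 20) * real (2 * (S + 1)\<^sup>2)"
    unfolding S_def
    by (rule ln_less_of_conic_approx [OF nm(1) assms(2,3) assms(4,5) [unfolded C]])
  ultimately have "ln M \<le> 25 ^ (4 * q)" by simp
  then have "ln (ln M) \<le> ln (25 ^ (4 * q))"
    using assms(2) by (intro ln_mono) auto
  also have "\<dots> = 4 * ln 25 * real q" by (simp add: ln_realpow)
  finally show "ln (ln M) \<le> 4 * ln 25 * real q" .
qed

text \<open>For fixed \<open>M > exp 1\<close> the quotient is unbounded as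
  \<open>\<epsilon>\<close> tends to 1 from below; keeping \<open>\<epsilon>\<close> out of the
  interval above \<open>\<epsilon>\<^sub>0\<close> gives
  \<open>ln (1 / \<epsilon>) \<ge> \<delta> > 0\<close> for all \<open>\<epsilon> < 1\<close>. The
  constant depends on \<open>\<epsilon>\<^sub>0\<close> alone.\<close>

theorem corollary5:
  fixes \<epsilon>\<^sub>0 :: real
  assumes "0 < \<epsilon>\<^sub>0" and "\<epsilon>\<^sub>0 < 1"
  shows "\<exists>c>0. \<forall>M>1. \<forall>\<epsilon>\<in>{0<..1}. \<epsilon> \<notin> {\<epsilon>\<^sub>0<..<1} \<longrightarrow>
           (\<forall>q C. second_order_conic_approx q C \<longrightarrow>
                   Kexp M (-\<epsilon>) \<subseteq> C \<longrightarrow> C \<subseteq> Kexp M \<epsilon> \<longrightarrow>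
                   real q \<ge> c * (1 + ln (ln M) / ln (1 / \<epsilon>)))"
proof -
  define \<delta> where "\<delta> = ln (1 / \<epsilon>\<^sub>0)"
  define \<kappa> :: real where "\<kappa> = 4 * ln 25"
  \<comment> \<open>From \<open>1 \<le> q\<close> and \<open>ln (ln M) \<le> \<kappa> * q\<close>,
    the expression in brackets is at most \<open>q + \<kappa> * q / \<delta>\<close>.\<close>
  define c where "c = 1 / (1 + \<kappa> / \<delta>)"
  have "\<delta> > 0" using assms by (simp add: \<delta>_def)
  have "\<kappa> > 0" by (simp add: \<kappa>_def)
  have "c > 0" using \<open>\<delta> > 0\<close> \<open>\<kappa> > 0\<close> by (simp add: c_def add_pos_pos)
  moreover have "c * (1 + ln (ln M) / ln (1 / \<epsilon>)) \<le> real q"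
    if "M > 1" and eps: "\<epsilon> \<in> {0<..1}" "\<epsilon> \<notin> {\<epsilon>\<^sub>0<..<1}"
      and C: "second_order_conic_approx q C" "Kexp M (-\<epsilon>) \<subseteq> C" "C \<subseteq> Kexp M \<epsilon>" for M \<epsilon> q C
  proof -
    have q: "3 \<le> q" "ln (ln M) \<le> \<kappa> * real q"
      using ln_ln_le_of_conic_approx [OF C(1) \<open>M > 1\<close> _ C(2,3)] eps by (auto simp: \<kappa>_def)
    have "ln (ln M) / ln (1 / \<epsilon>) \<le> \<kappa> * real q / \<delta>"
    proof (cases "\<epsilon> = 1")
      \<comment> \<open>Here \<open>ln (1 / \<epsilon>) = 0\<close>, and division by zero yields
        0.\<close>
      case True
      then show ?thesis using \<open>\<kappa> > 0\<close> \<open>\<delta> > 0\<close> by simp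
    next
      case False
      then have "\<epsilon> \<le> \<epsilon>\<^sub>0" "\<epsilon> > 0" using eps by auto
      then have "\<delta> \<le> ln (1 / \<epsilon>)"
        unfolding \<delta>_def using assms by (intro ln_mono) (auto simp: frac_le)
      have "ln (ln M) / ln (1 / \<epsilon>) \<le> \<kappa> * real q / ln (1 / \<epsilon>)"
        using q \<open>\<delta> \<le> ln (1 / \<epsilon>)\<close> \<open>\<delta> > 0\<close> by (intro divide_right_mono) auto
      also have "\<dots> \<le> \<kappa> * real q / \<delta>"
        using \<open>\<delta> \<le> ln (1 / \<epsilon>)\<close> \<open>\<delta> > 0\<close> \<open>\<kappa> > 0\<close> by (intro divide_left_mono) auto
      finally show ?thesis .
    qed
    then have "1 + ln (ln M) / ln (1 / \<epsilon>) \<le> (1 + \<kappa> / \<delta>) * real q"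
      using q(1) by (simp add: algebra_simps)
    then have "c * (1 + ln (ln M) / ln (1 / \<epsilon>)) \<le> c * ((1 + \<kappa> / \<delta>) * real q)"
      using \<open>c > 0\<close> by (intro mult_left_mono) auto
    also have "\<dots> = real q"
      using \<open>\<delta> > 0\<close> \<open>\<kappa> > 0\<close> by (simp add: c_def add_pos_pos less_imp_neq [symmetric])
    finally show ?thesis .
  qed
  ultimately show ?thesis by blast
qed

end
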